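(* Let $n\ge 1$ and let $x_1,\dots,x_n\in\mathbb{R}^n$ be unit vectors. Let $X$ be the real $n\times n$ matrix whose $j$-th row is $x_j$, and let $\lambda_1\le\dots\le\lambda_n$ denote the eigenvalues (with multiplicity) of the Gram matrix $XX^{\ast}$ in increasing order. Then $$\max_{\|y\|=1}\prod_{j=1}^{n}|(Xy)_j|\ \ge\ \left(\frac{1}{\lambda_n}\right)^{n/2}\cdot n^{-n/2},$$ where the maximum is over unit vectors $y\in\mathbb{R}^n$.
   Context: $\mathbb{R}^n$ carries the standard inner product $\langle\cdot,\cdot\rangle$ and Euclidean norm $\|\cdot\|$. $X^{\ast}$ is the transpose of $X$, so $XX^{\ast}=[\langle x_i,x_j\rangle]_{i,j}$ is the Gram matrix of $x_1,\dots,x_n$, and $(Xy)_j=\langle x_j,y\rangle$. *)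

theory Defs
  imports
    "HOL-Analysis.Analysis"
    "HOL-Computational_Algebra.Computational_Algebra"
begin

definition charpoly :: "'a::comm_ring_1 ^ 'n ^ 'n \<Rightarrow> 'a poly" where
  "charpoly A = det (mat [:0, 1:] - map_matrix (\<lambda>a. [:a:]) A)"

text \<open>
  The real eigenvalues, each repeated according to its multiplicity as a root of the
  characteristic polynomial, in increasing order. For a symmetric matrix of size \<open>n\<close> all
  complex eigenvalues are real, so this list has length \<open>n\<close>.
\<close>
definition eigenvalues_sorted :: "real ^ 'n ^ 'n \<Rightarrow> real list" where
  "eigenvalues_sorted A = sorted_list_of_multiset (proots (charpoly A))"

text \<open>Eigenvalues are numbered from 1; only \<open>1 \<le> k \<le> n\<close> is meaningful.\<close>
definition nth_eigenvalue :: "real ^ 'n ^ 'n \<Rightarrow> nat \<Rightarrow> real" where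
  "nth_eigenvalue A k = eigenvalues_sorted A ! (k - 1)"

end

theory Submission
  imports Defs
begin

text \<open>
  The lower bound is Bang's sign argument.  Among all sums \<open>u = \<Sum>\<^sub>j \<epsilon>\<^sub>j x\<^sub>j\<close> with signs
  \<open>\<epsilon>\<^sub>j = \<plusminus>1\<close> take a longest one.  Flipping a single sign cannot lengthen it, and this says
  exactly that \<open>\<epsilon>\<^sub>j \<langle>x\<^sub>j, u\<rangle> \<ge> \<parallel>x\<^sub>j\<parallel>\<^sup>2 = 1\<close> for every \<open>j\<close> (\<open>Bang_signs\<close>); hence
  \<open>\<Prod>\<^sub>j \<bar>\<langle>x\<^sub>j, u\<rangle>\<bar> \<ge> 1\<close>.  On the other hand \<open>\<parallel>u\<parallel>\<^sup>2 = \<langle>\<epsilon>, X X\<^sup>* \<epsilon>\<rangle> \<le> \<lambda>\<^sub>n \<parallel>\<epsilon>\<parallel>\<^sup>2 = \<lambda>\<^sub>n n\<close>, so normalising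
  \<open>u\<close> costs at most a factor \<open>(\<lambda>\<^sub>n n)\<^sup>n\<^sup>/\<^sup>2\<close>.  The maximum over the sphere exists by compactness and
  dominates the value at \<open>u / \<parallel>u\<parallel>\<close>.

  The remaining work is to see that \<open>\<lambda>\<^sub>n\<close>, the \<open>n\<close>-th entry in a sorted list of roots of the
  characteristic polynomial, really bounds the quadratic form (\<open>quadratic_form_le_nth_eigenvalue\<close>).
  The maximum of the quadratic form on the unit sphere is an eigenvalue
  (\<open>symmetric_max_eigenvector\<close>), hence occurs in the list.  The \<open>n\<close>-th entry is the largest one
  provided that the list has length exactly \<open>n\<close>.  This holds because the characteristic polynomial
  has degree \<open>n\<close> and, for a symmetric matrix, all its complex roots are real, so that it splits over
  the reals (\<open>size_proots_charpoly_symmetric\<close>).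
\<close>

section \<open>The characteristic polynomial\<close>

text \<open>
  Both evaluation at a real point and evaluation at a complex point after extending the
  coefficients are ring homomorphisms, so this one fact computes the values of a characteristic
  polynomial over either field.
\<close>

lemma det_map_matrix:
  fixes h :: "'a::comm_ring_1 \<Rightarrow> 'b::comm_ring_1" and A :: "'a ^ 'n ^ 'n"
  assumes add: "\<And>a b. h (a + b) = h a + h b"
    and mult: "\<And>a b. h (a * b) = h a * h b"
    and one: "h 1 = 1"
  shows "h (det A) = det (map_matrix h A)"
proof -
  have zero: "h 0 = 0" using add[of 0 0] by simp
  have neg: "h (- a) = - h a" for a
    using add[of a "- a"] zero by (simp add: eq_neg_iff_add_eq_0 add.commute)
  have sum: "h (sum f S) = (\<Sum>s\<in>S. h (f s))" for f :: "('n \<Rightarrow> 'n) \<Rightarrow> 'a" and S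
    by (induction S rule: infinite_finite_induct) (auto simp: zero add)
  have prod: "h (prod f S) = (\<Prod>s\<in>S. h (f s))" for f :: "'n \<Rightarrow> 'a" and S
    by (induction S rule: infinite_finite_induct) (auto simp: one mult)
  have sgn: "h (of_int (sign p)) = of_int (sign p)" for p :: "'n \<Rightarrow> 'n"
    by (cases "evenperm p") (auto simp: sign_def one neg)
  show ?thesis
    by (simp add: det_def sum mult prod sgn)
qed

lemma coeff_prod_linear:
  fixes f :: "'i \<Rightarrow> 'a::comm_semiring_1 poly"
  assumes "finite S" "\<And>i. i \<in> S \<Longrightarrow> degree (f i) \<le> 1"
  shows "degree (prod f S) \<le> card S \<and> coeff (prod f S) (card S) = (\<Prod>i\<in>S. coeff (f i) 1)"
  using assms
proof (induction S rule: finite_induct)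
  case (insert i S)
  then have IH: "degree (prod f S) \<le> card S" "coeff (prod f S) (card S) = (\<Prod>i\<in>S. coeff (f i) 1)"
    and i: "degree (f i) \<le> 1"
    by auto
  have "coeff (f i * prod f S) (1 + card S) = coeff (f i) 1 * coeff (prod f S) (card S)"
  proof -
    have "coeff (f i * prod f S) (1 + card S)
        = (\<Sum>k\<le>1 + card S. coeff (f i) k * coeff (prod f S) (1 + card S - k))"
      by (rule coeff_mult)
    also have "\<dots> = (\<Sum>k\<in>{1}. coeff (f i) k * coeff (prod f S) (1 + card S - k))"
    proof (rule sum.mono_neutral_right)
      show "\<forall>k\<in>{..1 + card S} - {1}. coeff (f i) k * coeff (prod f S) (1 + card S - k) = 0"
      proof
        fix k assume "k \<in> {..1 + card S} - {1}"
        then consider "k = 0" | "k > 1" by fastforce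
        then show "coeff (f i) k * coeff (prod f S) (1 + card S - k) = 0"
          using IH(1) i by cases (auto simp: coeff_eq_0)
      qed
    qed auto
    finally show ?thesis by simp
  qed
  moreover have "degree (f i * prod f S) \<le> 1 + card S"
    using degree_mult_le[of "f i" "prod f S"] IH(1) i by linarith
  ultimately show ?case
    using insert.hyps IH(2) by simp
qed auto

text \<open>
  In the Leibniz expansion of \<open>det (t I - A)\<close> every entry is a polynomial of degree at most one,
  so the coefficient of \<open>t\<^sup>n\<close> is the determinant of the matrix of linear coefficients, which is the
  identity.
\<close>

lemma charpoly_monic:
  fixes A :: "'a::comm_ring_1 ^ 'n ^ 'n"
  shows "degree (charpoly A) = CARD('n) \<and> coeff (charpoly A) (CARD('n)) = 1"
proof -
  define M where "M = mat [:0, 1:] - map_matrix (\<lambda>a. [:a:]) A"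
  have M1: "degree (M $ i $ j) \<le> 1" and Mc: "coeff (M $ i $ j) 1 = mat 1 $ i $ j" for i j
    by (auto simp: M_def mat_def)
  have prod: "degree (\<Prod>i\<in>UNIV. M $ i $ p i) \<le> CARD('n)"
    "coeff (\<Prod>i\<in>UNIV. M $ i $ p i) (CARD('n)) = (\<Prod>i\<in>UNIV. mat 1 $ i $ p i)" for p :: "'n \<Rightarrow> 'n"
    using coeff_prod_linear[of UNIV "\<lambda>i. M $ i $ p i"] M1 Mc by auto
  have term_eq: "of_int (sign p) * q = smult (of_int (sign p)) q" for p :: "'n \<Rightarrow> 'n" and q :: "'a poly"
    by (simp add: of_int_poly)
  have "degree (det M) \<le> CARD('n)"
    unfolding det_def term_eq
    by (intro degree_sum_le finite_permutations finite order_trans[OF degree_smult_le] prod)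
  moreover have "coeff (det M) (CARD('n)) = det (mat 1 :: 'a ^ 'n ^ 'n)"
    unfolding det_def term_eq by (simp add: coeff_sum prod)
  ultimately show ?thesis
    by (metis M_def charpoly_def det_I le_antisym le_degree one_neq_zero)
qed

lemma det_eq_0_iff_eigenvector:
  fixes A :: "'a::field ^ 'n ^ 'n"
  shows "det (mat c - A) = 0 \<longleftrightarrow> (\<exists>v. v \<noteq> 0 \<and> A *v v = c *s v)"
proof -
  have mat: "mat c *v v = c *s v" for v :: "'a ^ 'n"
    by (simp add: vec_eq_iff matrix_vector_mult_def mat_def if_distrib[of "\<lambda>x. x * y" for y] cong: if_cong)
  have "det (mat c - A) = 0 \<longleftrightarrow> (\<exists>v. v \<noteq> 0 \<and> (mat c - A) *v v = 0)"
    using invertible_det_nz[of "mat c - A"] invertible_left_inverse[of "mat c - A"]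
      matrix_left_invertible_ker[of "mat c - A"] by blast
  also have "\<dots> \<longleftrightarrow> (\<exists>v. v \<noteq> 0 \<and> A *v v = c *s v)"
    by (auto simp: matrix_vector_mult_diff_rdistrib mat)
  finally show ?thesis .
qed

lemma poly_charpoly: "poly (charpoly A) c = det (mat c - A)"
proof -
  have "poly (charpoly A) c = det (map_matrix (\<lambda>p. poly p c) (mat [:0, 1:] - map_matrix (\<lambda>a. [:a:]) A))"
    unfolding charpoly_def by (rule det_map_matrix) auto
  also have "map_matrix (\<lambda>p. poly p c) (mat [:0, 1:] - map_matrix (\<lambda>a. [:a:]) A) = mat c - A"
    by (simp add: vec_eq_iff mat_def)
  finally show ?thesis .
qed

lemma map_poly_of_real_mult:
  "map_poly complex_of_real (p * q) = map_poly complex_of_real p * map_poly complex_of_real q"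
  by (rule poly_eqI) (simp add: coeff_map_poly coeff_mult)

lemma map_poly_of_real_add:
  "map_poly complex_of_real (p + q) = map_poly complex_of_real p + map_poly complex_of_real q"
  by (rule poly_eqI) (simp add: coeff_map_poly)

lemma poly_of_real_charpoly:
  "poly (map_poly complex_of_real (charpoly A)) z = det (mat z - map_matrix complex_of_real A)"
proof -
  let ?h = "\<lambda>p. poly (map_poly complex_of_real p) z"
  have "?h (charpoly A) = det (map_matrix ?h (mat [:0, 1:] - map_matrix (\<lambda>a. [:a:]) A))"
    unfolding charpoly_def
    by (rule det_map_matrix) (auto simp: map_poly_of_real_add map_poly_of_real_mult)
  also have "map_matrix ?h (mat [:0, 1:] - map_matrix (\<lambda>a. [:a:]) A)
      = mat z - map_matrix complex_of_real A"
    by (simp add: vec_eq_iff mat_def map_poly_pCons)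
  finally show ?thesis .
qed

section \<open>The spectrum of a real symmetric matrix\<close>

lemma inner_symmetric_matrix:
  fixes A :: "real ^ 'n ^ 'n"
  assumes "transpose A = A"
  shows "u \<bullet> (A *v w) = (A *v u) \<bullet> w"
  by (metis assms dot_lmul_matrix transpose_matrix_vector)

text \<open>
  Splitting a complex eigenvector into real and imaginary parts \<open>u\<close> and \<open>w\<close> turns the eigenvalue
  equation into two real ones; comparing \<open>\<langle>u, A w\<rangle>\<close> with \<open>\<langle>A u, w\<rangle>\<close> leaves
  \<open>Im z (\<parallel>u\<parallel>\<^sup>2 + \<parallel>w\<parallel>\<^sup>2) = 0\<close>.
\<close>

lemma symmetric_charpoly_roots_real:
  fixes A :: "real ^ 'n ^ 'n"
  assumes sym: "transpose A = A"
    and root: "poly (map_poly complex_of_real (charpoly A)) z = 0"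
  shows "Im z = 0"
proof -
  obtain v where v: "v \<noteq> 0" "map_matrix complex_of_real A *v v = z *s v"
    using root det_eq_0_iff_eigenvector[of z "map_matrix complex_of_real A"]
    by (auto simp: poly_of_real_charpoly)
  define u w where "u = (\<chi> i. Re (v $ i))" and "w = (\<chi> i. Im (v $ i))"
  have eq: "(\<Sum>j\<in>UNIV. complex_of_real (A $ i $ j) * v $ j) = z * v $ i" for i
    using arg_cong[OF v(2), of "\<lambda>x. x $ i"] by (simp add: matrix_vector_mult_def)
  have Au: "A *v u = Re z *\<^sub>R u - Im z *\<^sub>R w"
    using arg_cong[OF eq, of Re] by (simp add: vec_eq_iff matrix_vector_mult_def u_def w_def)
  have Aw: "A *v w = Im z *\<^sub>R u + Re z *\<^sub>R w"
    using arg_cong[OF eq, of Im] by (simp add: vec_eq_iff matrix_vector_mult_def u_def w_def)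
  have "Im z * (u \<bullet> u + w \<bullet> w) = 0"
    using inner_symmetric_matrix[OF sym, of u w] unfolding Au Aw
    by (simp add: inner_simps inner_commute algebra_simps)
  moreover have "u \<noteq> 0 \<or> w \<noteq> 0"
    using v(1) by (auto simp: vec_eq_iff u_def w_def complex_eq_iff)
  then have "u \<bullet> u + w \<bullet> w > 0"
    by (metis add_nonneg_pos add_pos_nonneg inner_ge_zero inner_gt_zero_iff)
  ultimately show ?thesis by simp
qed

text \<open>A complex root exists by the fundamental theorem of algebra; being real, it splits off a
  real linear factor, and the cofactor inherits the hypothesis.\<close>

lemma size_proots_if_roots_real:
  fixes p :: "real poly"
  assumes "p \<noteq> 0" "\<And>z. poly (map_poly complex_of_real p) z = 0 \<Longrightarrow> Im z = 0"
  shows "size (proots p) = degree p"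
  using assms
proof (induction "degree p" arbitrary: p)
  case 0
  then show ?case
    by (metis degree_0_id proots_const size_empty)
next
  case (Suc m)
  have "degree (map_poly complex_of_real p) = degree p"
    by (rule degree_map_poly) auto
  then have "\<not> constant (poly (map_poly complex_of_real p))"
    using Suc.hyps(2) by (simp add: constant_degree)
  then obtain z where z: "poly (map_poly complex_of_real p) z = 0"
    using fundamental_theorem_of_algebra by blast
  then have "z = of_real (Re z)"
    using Suc.prems(2) by (simp add: complex_eq_iff)
  moreover have "poly (map_poly complex_of_real q) (of_real r) = of_real (poly q r)" for q r
    by (induction q) (auto simp: map_poly_pCons)
  ultimately have "poly p (Re z) = 0"
    using z by (metis of_real_eq_0_iff)
  then obtain q where q: "p = [:- Re z, 1:] * q"
    by (auto simp: poly_eq_0_iff_dvd)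
  have "q \<noteq> 0" using q Suc.prems(1) by auto
  then have deg: "degree p = Suc (degree q)"
    unfolding q by (subst degree_mult_eq) auto
  have "size (proots q) = degree q"
    using Suc.hyps deg \<open>q \<noteq> 0\<close> Suc.prems(2)
    by (auto simp: q map_poly_of_real_mult simp del: mult_pCons_left)
  then show ?case
    using deg \<open>q \<noteq> 0\<close> by (subst q) (simp add: proots_mult del: mult_pCons_left)
qed

lemma size_proots_charpoly_symmetric:
  fixes A :: "real ^ 'n ^ 'n"
  assumes "transpose A = A"
  shows "size (proots (charpoly A)) = CARD('n)"
proof -
  have "charpoly A \<noteq> 0"
    using charpoly_monic[of A] by auto
  then show ?thesis
    using size_proots_if_roots_real symmetric_charpoly_roots_real[OF assms] charpoly_monic[of A]
    by metis
qed

text \<open>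
  At a maximiser \<open>v\<close> with value \<open>m\<close> the nonnegative quadratic form of \<open>B = m I - A\<close> vanishes.
  Moving from \<open>v\<close> a small step \<open>t\<close> against \<open>B v\<close> changes it by \<open>- 2 t \<parallel>B v\<parallel>\<^sup>2 + O(t\<^sup>2)\<close>, which is
  negative unless \<open>B v = 0\<close>.
\<close>

lemma symmetric_max_eigenvector:
  fixes A :: "real ^ 'n ^ 'n"
  assumes sym: "transpose A = A"
  obtains v m where "norm v = 1" "A *v v = m *\<^sub>R v" "\<And>w. w \<bullet> (A *v w) \<le> m * (norm w)\<^sup>2"
proof -
  have "compact (sphere (0 :: real ^ 'n) 1)" by simp
  moreover have "sphere (0 :: real ^ 'n) 1 \<noteq> {}" by simp
  moreover have "continuous_on (sphere 0 1) (\<lambda>w. w \<bullet> (A *v w))"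
    by (intro continuous_intros matrix_vector_mult_linear_continuous_on)
  ultimately obtain v where v: "v \<in> sphere 0 1"
    and max: "\<And>w. w \<in> sphere 0 1 \<Longrightarrow> w \<bullet> (A *v w) \<le> v \<bullet> (A *v v)"
    using continuous_attains_sup[of "sphere 0 1" "\<lambda>w. w \<bullet> (A *v w)"] by blast
  define m where "m = v \<bullet> (A *v v)"
  have bound: "w \<bullet> (A *v w) \<le> m * (norm w)\<^sup>2" for w
  proof (cases "w = 0")
    case False
    define s where "s = w /\<^sub>R norm w"
    have "w = norm w *\<^sub>R s" "s \<in> sphere 0 1"
      using False by (auto simp: s_def)
    have "w \<bullet> (A *v w) = (norm w *\<^sub>R s) \<bullet> (A *v (norm w *\<^sub>R s))"
      using \<open>w = norm w *\<^sub>R s\<close> by simp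
    also have "\<dots> = (norm w)\<^sup>2 * (s \<bullet> (A *v s))"
      by (simp only: matrix_vector_mult_scaleR inner_scaleR_left inner_scaleR_right power2_eq_square mult.assoc)
    also have "\<dots> \<le> (norm w)\<^sup>2 * m"
      using max[OF \<open>s \<in> sphere 0 1\<close>] unfolding m_def by (intro mult_left_mono) auto
    finally show ?thesis by (simp add: mult.commute)
  qed simp
  define B where "B w = m *\<^sub>R w - A *v w" for w
  have B_nonneg: "w \<bullet> B w \<ge> 0" for w
    using bound[of w] by (simp add: B_def inner_diff_right power2_norm_eq_inner)
  have B_sym: "w \<bullet> B u = B w \<bullet> u" for w u
    using inner_symmetric_matrix[OF sym, of w u] by (simp add: B_def inner_simps)
  have vv: "v \<bullet> B v = 0"
    using v by (simp add: B_def inner_diff_right m_def flip: power2_norm_eq_inner)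
  have B_lin: "B (u - t *\<^sub>R w) = B u - t *\<^sub>R B w" for u w t
    by (simp add: B_def algebra_simps matrix_vector_mult_diff_distrib matrix_vector_mult_scaleR)
  define c where "c = B v \<bullet> B (B v)"
  define d where "d = B v \<bullet> B v"
  have "c \<ge> 0" using B_nonneg by (simp add: c_def)
  have step: "2 * t * d \<le> t\<^sup>2 * c" for t
  proof -
    have "(v - t *\<^sub>R B v) \<bullet> B (v - t *\<^sub>R B v) = t\<^sup>2 * c - 2 * t * d"
      unfolding B_lin using vv B_sym[of v "B v"]
      by (simp add: inner_simps c_def d_def power2_eq_square algebra_simps)
    then show ?thesis
      using B_nonneg[of "v - t *\<^sub>R B v"] by simp
  qed
  have "d = 0"
  proof (rule ccontr)
    assume "d \<noteq> 0"
    then have "d > 0" by (simp add: d_def)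
    (* Small enough that t * c stays below d, so that the linear term of step wins. *)
    define t where "t = d / (1 + c)"
    have "t > 0" using \<open>d > 0\<close> \<open>c \<ge> 0\<close> by (simp add: t_def)
    then have "2 * d \<le> t * c"
      using step[of t] by (simp add: power2_eq_square mult.assoc mult.left_commute)
    moreover have "t * c \<le> d"
      using \<open>d > 0\<close> \<open>c \<ge> 0\<close> by (simp add: t_def field_simps)
    ultimately show False using \<open>d > 0\<close> by simp
  qed
  then have "A *v v = m *\<^sub>R v"
    by (simp add: d_def B_def)
  then show thesis
    using v bound by (intro that) auto
qed

lemma quadratic_form_le_nth_eigenvalue:
  fixes A :: "real ^ 'n ^ 'n"
  assumes sym: "transpose A = A"
  shows "w \<bullet> (A *v w) \<le> nth_eigenvalue A (CARD('n)) * (norm w)\<^sup>2"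
proof -
  obtain v m where v: "norm v = 1" "A *v v = m *\<^sub>R v"
    and bound: "\<And>w. w \<bullet> (A *v w) \<le> m * (norm w)\<^sup>2"
    using symmetric_max_eigenvector[OF sym] by metis
  have "v \<noteq> 0" using v(1) by auto
  then have "poly (charpoly A) m = 0"
    unfolding poly_charpoly det_eq_0_iff_eigenvector using v(2)
    by (auto simp: scalar_mult_eq_scaleR)
  moreover have "charpoly A \<noteq> 0"
    using charpoly_monic[of A] by auto
  ultimately have "m \<in> set (eigenvalues_sorted A)"
    by (simp add: eigenvalues_sorted_def flip: set_mset_mset)
  moreover have len: "length (eigenvalues_sorted A) = CARD('n)"
    using size_proots_charpoly_symmetric[OF sym]
    by (metis eigenvalues_sorted_def mset_sorted_list_of_multiset size_mset)
  ultimately obtain k where "k < CARD('n)" "eigenvalues_sorted A ! k = m"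
    by (metis in_set_conv_nth)
  moreover have "sorted (eigenvalues_sorted A)"
    by (simp add: eigenvalues_sorted_def)
  ultimately have "m \<le> nth_eigenvalue A (CARD('n))"
    using len by (auto simp: nth_eigenvalue_def intro!: sorted_nth_mono)
  then show ?thesis
    using bound[of w] by (meson mult_right_mono order_trans zero_le_power2)
qed

section \<open>Bang's sign argument\<close>

text \<open>
  Choose the signs so that \<open>u = \<Sum>\<^sub>i \<epsilon>\<^sub>i x\<^sub>i\<close> is as long as possible.  Flipping the \<open>j\<close>-th sign
  replaces \<open>u\<close> by \<open>u - 2 \<epsilon>\<^sub>j x\<^sub>j\<close>, whose squared length is
  \<open>\<parallel>u\<parallel>\<^sup>2 - 4 \<epsilon>\<^sub>j \<langle>x\<^sub>j, u\<rangle> + 4 \<parallel>x\<^sub>j\<parallel>\<^sup>2\<close>; maximality of \<open>\<parallel>u\<parallel>\<close> makes the last two terms nonpositive.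
\<close>

lemma Bang_signs:
  fixes x :: "'i::finite \<Rightarrow> 'a::real_inner"
  obtains e where "\<And>i. \<bar>e i\<bar> = (1::real)"
    and "\<And>j. (norm (x j))\<^sup>2 \<le> e j * (x j \<bullet> (\<Sum>i\<in>UNIV. e i *\<^sub>R x i))"
proof -
  define E where "E = {e :: 'i \<Rightarrow> real. \<forall>i. \<bar>e i\<bar> = 1}"
  define s where "s e = (\<Sum>i\<in>UNIV. e i *\<^sub>R x i)" for e
  have "E \<subseteq> (UNIV :: 'i set) \<rightarrow>\<^sub>E {1, -1}"
    by (auto simp: E_def abs_if split: if_splits)
  then have "finite E"
    by (rule finite_subset) (intro finite_PiE, auto)
  moreover have "(\<lambda>_. 1) \<in> E" by (simp add: E_def)
  ultimately obtain e where e: "e \<in> E" and max: "\<And>e'. e' \<in> E \<Longrightarrow> norm (s e') \<le> norm (s e)"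
    using obtains_MAX[of E "\<lambda>e. norm (s e)"] by (metis Max_ge empty_iff finite_imageI image_eqI)
  show thesis
  proof
    show "\<bar>e i\<bar> = 1" for i using e by (simp add: E_def)
    fix j
    have "s (e(j := - e j)) = s e - (2 * e j) *\<^sub>R x j"
      by (simp add: s_def sum.remove[of UNIV j] algebra_simps flip: scaleR_2)
    moreover have "e(j := - e j) \<in> E"
      using e by (simp add: E_def)
    ultimately have "(norm (s e - (2 * e j) *\<^sub>R x j))\<^sup>2 \<le> (norm (s e))\<^sup>2"
      using max[of "e(j := - e j)"] by (simp add: power_mono)
    moreover have "e j * (e j * a) = a" for a
      using e abs_mult_self_eq[of "e j"] by (simp add: E_def flip: mult.assoc)
    ultimately show "(norm (x j))\<^sup>2 \<le> e j * (x j \<bullet> (\<Sum>i\<in>UNIV. e i *\<^sub>R x i))"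
      unfolding s_def[symmetric] power2_norm_eq_inner
      by (simp add: inner_simps inner_commute algebra_simps)
  qed
qed

lemma inner_Gram_matrix:
  fixes X :: "real ^ 'm ^ 'n"
  shows "e \<bullet> ((X ** transpose X) *v e) = (norm (\<Sum>j\<in>UNIV. e $ j *\<^sub>R X $ j))\<^sup>2"
proof -
  have "transpose X *v e = (\<Sum>j\<in>UNIV. e $ j *\<^sub>R X $ j)"
    by (simp add: vec_eq_iff matrix_vector_mult_def transpose_def mult.commute)
  moreover have "e \<bullet> ((X ** transpose X) *v e) = (norm (transpose X *v e))\<^sup>2"
    by (metis dot_lmul_matrix matrix_vector_mul_assoc power2_norm_eq_inner transpose_matrix_vector)
  ultimately show ?thesis by simp
qed

theorem theorem2p4:
  fixes x :: "'n::finite \<Rightarrow> real ^ 'n"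
    and X :: "real ^ 'n ^ 'n"
    and n :: nat
    and ev :: "nat \<Rightarrow> real"
  assumes n: "n = CARD('n)"
    and unit: "\<And>j. norm (x j) = 1"
    and X: "X = (\<chi> j. x j)"
    and ev: "ev = nth_eigenvalue (X ** transpose X)"
  shows "\<exists>y. norm y = 1
      \<and> (\<forall>z. norm z = 1 \<longrightarrow> (\<Prod>j\<in>UNIV. \<bar>(X *v z) $ j\<bar>) \<le> (\<Prod>j\<in>UNIV. \<bar>(X *v y) $ j\<bar>))
      \<and> (\<Prod>j\<in>UNIV. \<bar>(X *v y) $ j\<bar>) \<ge> (1 / ev n) powr (real n / 2) * real n powr (- (real n / 2))"
proof -
  let ?F = "\<lambda>y. \<Prod>j\<in>UNIV. \<bar>(X *v y) $ j\<bar>"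
  have Xy: "(X *v y) $ j = x j \<bullet> y" for y j
    by (simp add: X matrix_vector_mult_def inner_vec_def)
  have "continuous_on (sphere 0 1) ?F"
    unfolding Xy by (intro continuous_intros)
  moreover have "compact (sphere (0 :: real ^ 'n) 1)" "sphere (0 :: real ^ 'n) 1 \<noteq> {}"
    by simp_all
  ultimately obtain y where y: "y \<in> sphere 0 1" and max: "\<And>z. z \<in> sphere 0 1 \<Longrightarrow> ?F z \<le> ?F y"
    using continuous_attains_sup[of "sphere 0 1" ?F] by blast

  obtain e where e: "\<And>i. \<bar>e i\<bar> = 1"
    and Bang: "\<And>j. (norm (x j))\<^sup>2 \<le> e j * (x j \<bullet> (\<Sum>i\<in>UNIV. e i *\<^sub>R x i))"
    using Bang_signs[of x] by metis
  define u where "u = (\<Sum>i\<in>UNIV. e i *\<^sub>R x i)"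
  have u: "1 \<le> \<bar>x j \<bullet> u\<bar>" for j
    using Bang[of j] abs_ge_self[of "e j * (x j \<bullet> u)"] by (simp add: u_def unit e abs_mult)
  then have "u \<noteq> 0"
    by (metis abs_zero inner_zero_right not_one_le_zero)
  have "n > 0" by (simp add: n)
  have "transpose (X ** transpose X) = X ** transpose X"
    by (simp add: matrix_transpose_mul)
  from quadratic_form_le_nth_eigenvalue[OF this, of "\<chi> i. e i"]
  have "(norm u)\<^sup>2 \<le> ev n * (norm (\<chi> i. e i))\<^sup>2"
    by (simp add: inner_Gram_matrix u_def X ev n)
  also have "(norm (\<chi> i. e i))\<^sup>2 = real n"
  proof -
    have "e i * e i = 1" for i
      using e[of i] abs_mult_self_eq[of "e i"] by simp
    then show ?thesis
      unfolding power2_norm_eq_inner inner_vec_def by (simp add: n)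
  qed
  finally have u_le: "(norm u)\<^sup>2 \<le> ev n * real n" .
  have "(norm u)\<^sup>2 > 0" using \<open>u \<noteq> 0\<close> by simp
  then have "ev n > 0"
    using u_le \<open>n > 0\<close> order_less_le_trans[of 0 "(norm u)\<^sup>2" "ev n * real n"]
    by (simp add: zero_less_mult_iff)

  have "(1 / ev n) powr (real n / 2) * real n powr (- (real n / 2))
      = (ev n * real n) powr (- (real n / 2))"
    using \<open>ev n > 0\<close> by (simp add: powr_mult powr_minus powr_divide divide_simps)
  also have "\<dots> \<le> ((norm u)\<^sup>2) powr (- (real n / 2))"
    using u_le \<open>(norm u)\<^sup>2 > 0\<close> by (intro powr_mono2') auto
  also have "\<dots> = (1 / norm u) ^ n"
    using \<open>u \<noteq> 0\<close> by (simp add: powr_minus powr_powr powr_realpow power_one_over flip: powr_numeral)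
     (simp add: divide_simps)
  also have "\<dots> = (\<Prod>j\<in>(UNIV :: 'n set). 1 / norm u)"
    by (simp add: n)
  also have "\<dots> \<le> ?F (u /\<^sub>R norm u)"
    unfolding Xy using u by (intro prod_mono) (auto simp: abs_mult divide_simps)
  also have "\<dots> \<le> ?F y"
    using \<open>u \<noteq> 0\<close> by (intro max) simp
  finally show ?thesis
    using y max by auto
qed

end
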